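(* For the procedure div-search (described in the context), if it can stop in a certain iteration, then one of the following conditions should be satisfied in that iteration before invoking the diversity search on the current set: 1) the last generated result $v=\emptyset$ (i.e. the generator has no further result); 2) $|S|\ge|S'|+k-\max\{i\mid 1\le i\le k,\ D_i(S')\neq\emptyset\}$ and the $k$-th largest score in $S$ is at least $\overline{u}$. Here $S$ is the current set of generated results, $\overline{u}$ is the current score upper bound for the unseen results, and $S'$ is the set of generated results when the diversity search on the current set was last invoked, or $\emptyset$ if it has never been invoked.
   Context: Each result $v$ has a score $\mathrm{score}(v)$. Two distinct results $v,w$ are similar, written $v\approx w$, iff $\mathrm{sim}(v,w)>\tau$, where $\mathrm{sim}$ is a user-defined similarity function with values in $[0,1]$ and $0<\tau\le 1$ is a user-defined threshold. For a set $A$ of results, the diversity graph $G(A)$ is the undirected graph with node set $A$ and an edge between two distinct results $v,w$ iff $v\approx w$. For a set $T$ of results, $\mathrm{score}(T)=\sum_{v\in T}\mathrm{score}(v)$. $D(A)$ is an independent set of $G(A)$ with at most $k$ elements and maximum total score. For $1\le i\le k$, $D_i(A)$ is an independent set of $G(A)$ with exactly $i$ elements and maximum total score among all such sets; $D_i(A)=\emptyset$ if $G(A)$ has no independent set with $i$ elements. The maximum over an empty set of indices (as when $S'=\emptyset$) is taken to be $0$. Procedure div-search with parameter $k$: start with $S=\emptyset$. In each iteration the underlying top-$k$ algorithm generates a next result $v$ ($v=\emptyset$ if there is none), which is added to $S$, and $\overline{u}$ is updated; $\overline{u}$ is the score of the last generated result if results are generated in non-increasing order of score, and otherwise a maintained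 upper bound on the scores of the unseen results. After that, the diversity search on the current set may be invoked; it computes $D(S)$ and all $D_i(S)$, $1\le i\le k$. The procedure stops when the sufficient stop condition $\mathrm{score}(D(S))\ge\overline{\mathrm{best}}(S)$ holds, where $$\overline{\mathrm{best}}(S)=\max_{1\le i\le k}\{\mathrm{score}(D_i(S))+(k-i)\times\overline{u}\},$$ or when there are no further results to generate.
   Formalization: Added, since the claim fails without them: all scores are nonnegative; the current upper bound u is positive; and for k = 1 results are generated in non-increasing order of score (u being the last generated score, not merely an upper bound). *)

theory Defs
  imports Complex_Main "HOL-Library.Multiset"
begin

definition similar :: "('a \<Rightarrow> 'a \<Rightarrow> real) \<Rightarrow> real \<Rightarrow> 'a \<Rightarrow> 'a \<Rightarrow> bool" where
  "similar sim \<tau> v w \<longleftrightarrow> v \<noteq> w \<and> sim v w > \<tau>"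

text \<open>A graph is a pair of a node set and a set of edges, each edge being a two-element set of nodes.\<close>

definition diversity_graph ::
  "('a \<Rightarrow> 'a \<Rightarrow> real) \<Rightarrow> real \<Rightarrow> 'a set \<Rightarrow> 'a set \<times> 'a set set" where
  "diversity_graph sim \<tau> A = (A, {{v, w} | v w. v \<in> A \<and> w \<in> A \<and> similar sim \<tau> v w})"

definition independent_set :: "'a set \<times> 'a set set \<Rightarrow> 'a set \<Rightarrow> bool" where
  "independent_set G T \<longleftrightarrow> T \<subseteq> fst G \<and> (\<forall>v\<in>T. \<forall>w\<in>T. {v, w} \<notin> snd G)"

definition is_D :: "'a set \<times> 'a set set \<Rightarrow> ('a \<Rightarrow> real) \<Rightarrow> nat \<Rightarrow> 'a set \<Rightarrow> bool" where
  "is_D G score k T \<longleftrightarrow>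
     is_arg_max (sum score) (\<lambda>U. independent_set G U \<and> finite U \<and> card U \<le> k) T"

definition is_D_size :: "'a set \<times> 'a set set \<Rightarrow> ('a \<Rightarrow> real) \<Rightarrow> nat \<Rightarrow> 'a set \<Rightarrow> bool" where
  "is_D_size G score i T \<longleftrightarrow>
     (if \<exists>U. independent_set G U \<and> finite U \<and> card U = i
      then is_arg_max (sum score) (\<lambda>U. independent_set G U \<and> finite U \<and> card U = i) T
      else T = {})"

text \<open>Optimal sets need not be unique, so the outcome of the diversity search is given by
  arbitrary selection functions: \<^term>\<open>D A\<close> for the optimum with at most \<open>k\<close> elements and
  \<^term>\<open>Di i A\<close> for the optimum with exactly \<open>i\<close> elements, for each finite set \<open>A\<close> of results.\<close>

definition diversity_search ::
  "'a set \<Rightarrow> ('a \<Rightarrow> real) \<Rightarrow> ('a \<Rightarrow> 'a \<Rightarrow> real) \<Rightarrow> real \<Rightarrow> nat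
    \<Rightarrow> ('a set \<Rightarrow> 'a set) \<Rightarrow> (nat \<Rightarrow> 'a set \<Rightarrow> 'a set) \<Rightarrow> bool" where
  "diversity_search R score sim \<tau> k D Di \<longleftrightarrow>
     (\<forall>A. finite A \<and> A \<subseteq> R \<longrightarrow>
        is_D (diversity_graph sim \<tau> A) score k (D A) \<and>
        (\<forall>i\<in>{1..k}. is_D_size (diversity_graph sim \<tau> A) score i (Di i A)))"

definition best :: "('a \<Rightarrow> real) \<Rightarrow> nat \<Rightarrow> (nat \<Rightarrow> 'a set \<Rightarrow> 'a set) \<Rightarrow> 'a set \<Rightarrow> real \<Rightarrow> real" where
  "best score k Di S u = Max ((\<lambda>i. sum score (Di i S) + (real k - real i) * u) ` {1..k})"

definition sufficient_stop ::
  "('a \<Rightarrow> real) \<Rightarrow> nat \<Rightarrow> ('a set \<Rightarrow> 'a set) \<Rightarrow> (nat \<Rightarrow> 'a set \<Rightarrow> 'a set) \<Rightarrow> 'a set \<Rightarrow> real \<Rightarrow> bool" where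
  "sufficient_stop score k D Di S u \<longleftrightarrow> sum score (D S) \<ge> best score k Di S u"

text \<open>The two kinds of underlying top-\<open>k\<close> algorithms: \<open>Incremental\<close> ones generate results in
  non-increasing order of score, \<open>Bounding\<close> ones only maintain an upper bound for the unseen scores.\<close>

datatype framework = Incremental | Bounding

text \<open>Generating the next result \<open>v\<close> out of the set \<open>R\<close> of all results turns the generated set \<open>S\<close> and
  bound \<open>u\<close> into \<open>S1\<close> and \<open>u1\<close>.  \<^term>\<open>None\<close> is returned exactly if every result has been
  generated; an incremental bound, the score of the last actual result, then stays unchanged.\<close>

definition generate ::
  "'a set \<Rightarrow> ('a \<Rightarrow> real) \<Rightarrow> framework \<Rightarrow> 'a set \<Rightarrow> real \<Rightarrow> 'a option \<Rightarrow> 'a set \<Rightarrow> real \<Rightarrow> bool" where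
  "generate R score fw S u v S1 u1 \<longleftrightarrow>
     (case v of
        None \<Rightarrow> R - S = {} \<and> S1 = S
      | Some x \<Rightarrow> x \<in> R - S \<and> S1 = insert x S) \<and>
     (case fw of
        Incremental \<Rightarrow>
          (case v of
             None \<Rightarrow> u1 = u
           | Some x \<Rightarrow> (\<forall>y\<in>S. score x \<le> score y) \<and> u1 = score x)
      | Bounding \<Rightarrow> (\<forall>y\<in>R - S1. score y \<le> u1))"

text \<open>\<open>div_search \<dots> S S' u v\<close> holds if some execution reaches an iteration in which, after
  generating \<open>v\<close> and before a possible diversity search, \<open>S\<close> is the generated set, \<open>u\<close> the
  bound, and \<open>S'\<close> the set at the last diversity search (empty if there was none).  The
  execution goes on after an iteration if a result was generated and the diversity search was
  either not invoked or did not establish the stop condition.\<close>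

inductive div_search ::
  "'a set \<Rightarrow> ('a \<Rightarrow> real) \<Rightarrow> framework \<Rightarrow> nat \<Rightarrow> ('a set \<Rightarrow> 'a set) \<Rightarrow> (nat \<Rightarrow> 'a set \<Rightarrow> 'a set)
    \<Rightarrow> 'a set \<Rightarrow> 'a set \<Rightarrow> real \<Rightarrow> 'a option \<Rightarrow> bool"
  for R score fw k D Di where
  first: "generate R score fw {} u0 v S u \<Longrightarrow> div_search R score fw k D Di S {} u v"
| not_invoked:
    "\<lbrakk>div_search R score fw k D Di S S' u (Some x);
      generate R score fw S u v S1 u1\<rbrakk>
     \<Longrightarrow> div_search R score fw k D Di S1 S' u1 v"
| invoked:
    "\<lbrakk>div_search R score fw k D Di S S' u (Some x);
      \<not> sufficient_stop score k D Di S u;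
      generate R score fw S u v S1 u1\<rbrakk>
     \<Longrightarrow> div_search R score fw k D Di S1 S u1 v"

definition can_stop ::
  "('a \<Rightarrow> real) \<Rightarrow> nat \<Rightarrow> ('a set \<Rightarrow> 'a set) \<Rightarrow> (nat \<Rightarrow> 'a set \<Rightarrow> 'a set)
    \<Rightarrow> 'a set \<Rightarrow> real \<Rightarrow> 'a option \<Rightarrow> bool" where
  "can_stop score k D Di S u v \<longleftrightarrow> v = None \<or> sufficient_stop score k D Di S u"

text \<open>The inserted \<open>0\<close> makes the maximum over the empty set \<open>0\<close>.\<close>

definition max_size :: "nat \<Rightarrow> (nat \<Rightarrow> 'a set \<Rightarrow> 'a set) \<Rightarrow> 'a set \<Rightarrow> nat" where
  "max_size k Di A = Max (insert 0 {i. 1 \<le> i \<and> i \<le> k \<and> Di i A \<noteq> {}})"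

text \<open>Counted with multiplicity; meaningful only for \<open>1 \<le> k \<le> card S\<close>.\<close>

definition kth_largest_score :: "('a \<Rightarrow> real) \<Rightarrow> nat \<Rightarrow> 'a set \<Rightarrow> real" where
  "kth_largest_score score k S =
     rev (sorted_list_of_multiset (image_mset score (mset_set S))) ! (k - 1)"

end

theory Submission
  imports Defs
begin

text \<open>Suppose the stop condition holds for \<open>S\<close>.  Comparing \<open>D S\<close> with the bound for \<open>i = card (D S)\<close>
  shows \<open>card (D S) = k\<close>, as otherwise \<open>(k - i) * u > 0\<close> would have to be nonpositive.  Comparing it
  with the bound for \<open>i = k - 1\<close> shows that dropping any element of \<open>D S\<close> loses at least \<open>u\<close>, so \<open>S\<close>
  has \<open>k\<close> elements of score at least \<open>u\<close>.  Finally \<open>D S \<inter> S'\<close> is independent in the graph of \<open>S'\<close>,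
  so at least \<open>k - max_size k Di S'\<close> elements of \<open>D S\<close> were generated after \<open>S'\<close>.\<close>

lemma independent_set_diversity_graph_subset:
  assumes "independent_set (diversity_graph sim \<tau> A) T" and "U \<subseteq> T" and "U \<subseteq> B" and "B \<subseteq> A"
  shows "independent_set (diversity_graph sim \<tau> B) U"
proof -
  have "snd (diversity_graph sim \<tau> B) \<subseteq> snd (diversity_graph sim \<tau> A)"
    using assms(4) by (auto simp: diversity_graph_def)
  moreover have "fst (diversity_graph sim \<tau> B) = B"
    by (simp add: diversity_graph_def)
  ultimately show ?thesis
    using assms(1-3) unfolding independent_set_def by (simp add: subset_iff) meson
qed

lemma independent_set_diversity_graph_singleton:
  assumes "x \<in> A"
  shows "independent_set (diversity_graph sim \<tau> A) {x}"
  using assms by (auto simp: independent_set_def diversity_graph_def similar_def doubleton_eq_iff)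

lemma is_D_D:
  assumes "is_D G score k T"
  shows "independent_set G T" and "finite T" and "card T \<le> k"
    and "\<lbrakk>independent_set G U; finite U; card U \<le> k\<rbrakk> \<Longrightarrow> sum score U \<le> sum score T"
  using assms by (auto simp: is_D_def is_arg_max_def not_less)

text \<open>The set \<open>U\<close> witnesses that size \<open>i\<close> is attained, which
  excludes the default value \<open>{}\<close> of \<open>T\<close>.\<close>

lemma is_D_size_D:
  assumes "is_D_size G score i T" and "independent_set G U" and "finite U" and "card U = i"
  shows "sum score U \<le> sum score T" and "card T = i"
proof -
  have "is_arg_max (sum score) (\<lambda>U. independent_set G U \<and> finite U \<and> card U = i) T"
    using assms unfolding is_D_size_def by (metis (no_types, lifting))
  then show "sum score U \<le> sum score T" "card T = i"
    using assms by (auto simp: is_arg_max_def not_less)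
qed

lemma best_ge:
  assumes "i \<in> {1..k}"
  shows "sum score (Di i S) + (real k - real i) * u \<le> best score k Di S u"
  unfolding best_def using assms by (intro Max_ge) auto

lemma div_search_generated_sets:
  assumes "div_search R score fw k D Di S S' u v"
  shows "finite S" and "S \<subseteq> R" and "S' \<subseteq> S"
  using assms
  by (induction rule: div_search.induct) (auto simp: generate_def split: option.splits)

lemma div_search_last_result:
  assumes "div_search R score fw k D Di S S' u (Some x)"
  shows "x \<in> S" and "fw = Incremental \<Longrightarrow> u = score x"
  using assms by (cases rule: div_search.cases; simp add: generate_def)+

lemma le_max_size:
  assumes "1 \<le> i" and "i \<le> k" and "Di i A \<noteq> {}"
  shows "i \<le> max_size k Di A"
  unfolding max_size_def using assms
  by (intro Max_ge) (auto intro: finite_subset[of _ "{..k}"])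

text \<open>In a descending list the entries that are at least \<open>u\<close> form a prefix. If
  entry \<open>n\<close> were below \<open>u\<close>, this prefix would lie within the first
  \<open>n\<close> positions.\<close>

lemma rev_sorted_nth_ge:
  fixes u :: "'a :: linorder"
  assumes "sorted (rev xs)" and "n < length (filter (\<lambda>y. u \<le> y) xs)"
  shows "u \<le> xs ! n"
proof (rule ccontr)
  assume "\<not> u \<le> xs ! n"
  then have "\<not> u \<le> xs ! m" if "n \<le> m" "m < length xs" for m
    using sorted_rev_nth_mono[OF assms(1) that] by simp
  then have "{i. i < length xs \<and> u \<le> xs ! i} \<subseteq> {..<n}"
    by (auto simp: not_le[symmetric])
  then have "length (filter (\<lambda>y. u \<le> y) xs) \<le> n"
    using card_mono[of "{..<n}"] by (simp add: length_filter_conv_card)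
  with assms(2) show False by simp
qed

lemma kth_largest_score_ge:
  assumes "finite S" and "T \<subseteq> S" and "card T = k" and "1 \<le> k"
    and "\<And>x. x \<in> T \<Longrightarrow> u \<le> score x"
  shows "u \<le> kth_largest_score score k S"
proof -
  let ?xs = "rev (sorted_list_of_multiset (image_mset score (mset_set S)))"
  have "mset (filter (\<lambda>y. u \<le> y) ?xs) = image_mset score (mset_set {x \<in> S. u \<le> score x})"
    using assms(1) by (simp add: filter_mset_image_mset)
  then have "length (filter (\<lambda>y. u \<le> y) ?xs) = card {x \<in> S. u \<le> score x}"
    by (metis size_mset size_image_mset size_mset_set)
  moreover have "k \<le> card {x \<in> S. u \<le> score x}"
    using assms by (auto intro!: card_mono simp flip: assms(3))
  ultimately show ?thesis
    unfolding kth_largest_score_def using assms(4) by (intro rev_sorted_nth_ge) auto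
qed

theorem lemma3:
  fixes R S S' :: "'a set"
    and score :: "'a \<Rightarrow> real"
    and sim :: "'a \<Rightarrow> 'a \<Rightarrow> real"
    and \<tau> u :: real
    and k :: nat
    and D :: "'a set \<Rightarrow> 'a set"
    and Di :: "nat \<Rightarrow> 'a set \<Rightarrow> 'a set"
    and fw :: framework
    and v :: "'a option"
  assumes "k \<ge> 1"
    and "0 < \<tau>" and "\<tau> \<le> 1"
    and "\<And>x y. x \<in> R \<Longrightarrow> y \<in> R \<Longrightarrow> 0 \<le> sim x y \<and> sim x y \<le> 1"
    and "\<And>x. x \<in> R \<Longrightarrow> 0 \<le> score x"
    and "diversity_search R score sim \<tau> k D Di"
    and "div_search R score fw k D Di S S' u v"
    and "0 < u"
    and "k = 1 \<Longrightarrow> fw = Incremental"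
    and "can_stop score k D Di S u v"
  shows "v = None \<or>
    (card S \<ge> card S' + k - max_size k Di S' \<and>
     k \<le> card S \<and> kth_largest_score score k S \<ge> u)"
proof (cases v)
  case None
  then show ?thesis by simp
next
  case (Some x)
  note run = assms(7)[unfolded Some]
  note gen = div_search_generated_sets[OF run] and last = div_search_last_result[OF run]
  let ?G = "\<lambda>A. diversity_graph sim \<tau> A"
  have D: "is_D (?G S) score k (D S)"
    using assms(6) gen by (auto simp: diversity_search_def)
  have Di: "is_D_size (?G A) score i (Di i A)" if "A \<subseteq> S" "1 \<le> i" "i \<le> k" for A i
  proof -
    have "finite A" "A \<subseteq> R" using gen that(1) by (auto intro: finite_subset)
    then show ?thesis using assms(6) that by (simp add: diversity_search_def)
  qed
  note D = is_D_D[OF D]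
  have DS: "D S \<subseteq> S"
    using D(1) by (simp add: independent_set_def diversity_graph_def)
  have stop: "sum score (Di i S) + (real k - real i) * u \<le> sum score (D S)"
    if "1 \<le> i" "i \<le> k" for i
    using assms(10) Some best_ge[of i k score Di S u] that
    by (auto simp: can_stop_def sufficient_stop_def)
  have x: "independent_set (?G S) {x}"
    using last(1) by (rule independent_set_diversity_graph_singleton)
  have Dx: "score x \<le> sum score (D S)"
    using D(4)[OF x] assms(1) by simp
  \<comment> \<open>Any nonempty independent set of at most \<open>k\<close> elements may replace
    the optimum of its size in the bound, since its score is no larger.\<close>
  have Di_pos: "sum score U + (real k - real (card U)) * u \<le> sum score (D S)"
    if "independent_set (?G S) U" "finite U" "1 \<le> card U" "card U \<le> k" for U
    using is_D_size_D(1)[OF Di that(1,2) refl] stop that by force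
  have card_D: "card (D S) = k"
  proof (rule ccontr)
    assume "card (D S) \<noteq> k"
    then have less: "card (D S) < k" using D(3) by simp
    show False
    proof (cases "D S = {}")
      case True
      \<comment> \<open>The bound has no index 0, so an empty \<open>D S\<close> is refuted at index
        1, with the singleton of the last result. For \<open>k = 1\<close> the term
        \<open>(real k - 1) * u\<close> vanishes and positivity comes from
        \<open>u = score x\<close>.\<close>
      have "0 \<le> score x" using last(1) gen(2) assms(5) by auto
      moreover have "score x + (real k - 1) * u \<le> 0"
        using Di_pos[OF x] assms(1) True by simp
      moreover have "0 < score x + (real k - 1) * u"
      proof (cases "k = 1")
        case True
        then show ?thesis using last(2) assms(8,9) by simp
      next
        case False
        then have "0 < (real k - 1) * u" using assms(1,8) by simp
        then show ?thesis using \<open>0 \<le> score x\<close> by simp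
      qed
      ultimately show False by simp
    next
      case False
      then have "1 \<le> card (D S)" using D(2) by (simp add: Suc_le_eq card_gt_0_iff)
      \<comment> \<open>Taking \<open>U = D S\<close>, its score cancels on both sides.\<close>
      then have "(real k - real (card (D S))) * u \<le> 0"
        using Di_pos[OF D(1,2)] less by simp
      then show False using less assms(8) by (simp add: mult_le_0_iff)
    qed
  qed
  have score_D: "u \<le> score y" if y: "y \<in> D S" for y
  proof (cases "k = 1")
    case True
    \<comment> \<open>Removing \<open>y\<close> would leave the empty set, which has no index in the
      bound. Instead, \<open>score y\<close> is the optimum, hence at least
      \<open>score x = u\<close>.\<close>
    then have "D S = {y}" using card_D y by (metis card_1_singletonE singletonD)
    then show ?thesis using Dx last(2) assms(9)[OF True] by simp
  next
    case False
    have "independent_set (?G S) (D S - {y})"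
      using DS by (intro independent_set_diversity_graph_subset[OF D(1)]) auto
    then show ?thesis
      \<comment> \<open>At index \<open>k - 1\<close> exactly one \<open>u\<close> is added, so the
        inequality reduces to \<open>u \<le> score y\<close>.\<close>
      using Di_pos[of "D S - {y}"] D(2) y card_D False assms(1)
      by (simp add: sum_diff1)
  qed
  have "card (D S \<inter> S') \<le> max_size k Di S'"
  proof (cases "D S \<inter> S' = {}")
    case True
    then show ?thesis by simp
  next
    case False
    let ?p = "card (D S \<inter> S')"
    have p: "1 \<le> ?p" "?p \<le> k"
      using False D(2) card_D card_mono[of "D S" "D S \<inter> S'"]
      by (auto simp: Suc_le_eq card_gt_0_iff)
    have "independent_set (?G S') (D S \<inter> S')"
      using gen(3) by (intro independent_set_diversity_graph_subset[OF D(1)]) auto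
    \<comment> \<open>Since \<open>?p\<close> is positive, \<open>Di ?p S'\<close> is nonempty and
      \<open>?p\<close> is among the indices that \<open>max_size\<close> ranges over.\<close>
    then have "card (Di ?p S') = ?p"
      using is_D_size_D(2)[OF Di[OF gen(3) p]] D(2) by simp
    then show ?thesis using p by (intro le_max_size) auto
  qed
  moreover have "card (D S - S') \<le> card S - card S'"
    using gen DS by (metis Diff_mono card_Diff_subset card_mono finite_Diff finite_subset order_refl)
  moreover have "card (D S \<inter> S') + card (D S - S') = k"
    using card_D D(2) by (metis card_Int_Diff)
  moreover have "card S' \<le> card S" using gen by (simp add: card_mono)
  ultimately have "card S' + k - max_size k Di S' \<le> card S" by simp
  moreover have "k \<le> card S" using card_D DS gen(1) by (metis card_mono)
  moreover have "u \<le> kth_largest_score score k S"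
    using kth_largest_score_ge[OF gen(1) DS card_D assms(1) score_D] .
  ultimately show ?thesis by simp
qed

end
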